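(* In the graceful game, Bob has a winning strategy on every helm $H_n$, $n\geq 3$ (no matter who starts).
   Context: The helm $H_n$ ($n\geq 3$) has a center $v_0$, cycle vertices $v_1,\dots,v_n$ forming a cycle and all adjacent to $v_0$, and pendent vertices $v_{n+1},\dots,v_{2n}$, where $v_{n+k}$ is adjacent only to $v_k$ ($1\leq k\leq n$). It has $2n+1$ vertices and $3n$ edges. A graceful labeling of a graph $G$ with $m$ edges is an injective map $f\colon V(G)\to\{0,1,\dots,m\}$ such that the induced edge labels $|f(u)-f(v)|$, $uv\in E(G)$, are pairwise distinct. The graceful game on a simple graph $G$ with $m$ edges: two players, Alice and Bob, alternately choose a free (not yet labeled) vertex and assign to it a label from $\{0,1,\dots,m\}$ not yet used. An edge both of whose endpoints are labeled gets label $|f(u)-f(v)|$; a move is legal only if after it all edge labels are pairwise distinct. Alice wins if the whole graph ends up gracefully labeled; Bob wins if he can prevent this. Either player may be the first to move. *)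

theory Defs
  imports Main
begin

text \<open>A simple graph is a pair of a vertex set and a set of two-element sets of vertices.\<close>

type_synonym 'a graph = "'a set \<times> 'a set set"

abbreviation verts :: "'a graph \<Rightarrow> 'a set" where
  "verts G \<equiv> fst G"

abbreviation edges :: "'a graph \<Rightarrow> 'a set set" where
  "edges G \<equiv> snd G"

definition simple_graph :: "'a graph \<Rightarrow> bool" where
  "simple_graph G \<longleftrightarrow> finite (verts G) \<and> (\<forall>e\<in>edges G. e \<subseteq> verts G \<and> card e = 2)"

definition edge_label :: "('a \<Rightarrow> nat) \<Rightarrow> 'a set \<Rightarrow> int" where
  "edge_label f e = (THE d. \<exists>u v. e = {u, v} \<and> d = \<bar>int (f u) - int (f v)\<bar>)"

lemma edge_label_pair: "edge_label f {u, v} = \<bar>int (f u) - int (f v)\<bar>"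
  unfolding edge_label_def by (rule the_equality) (auto simp: doubleton_eq_iff)

definition graceful_labeling :: "'a graph \<Rightarrow> ('a \<Rightarrow> nat) \<Rightarrow> bool" where
  "graceful_labeling G f \<longleftrightarrow>
     inj_on f (verts G) \<and> f ` verts G \<subseteq> {0..card (edges G)} \<and>
     inj_on (edge_label f) (edges G)"


datatype player = Alice | Bob

text \<open>A position of the game is the partial labeling produced so far.\<close>

type_synonym 'a position = "'a \<rightharpoonup> nat"

definition distinct_edge_labels :: "'a graph \<Rightarrow> 'a position \<Rightarrow> bool" where
  "distinct_edge_labels G p \<longleftrightarrow>
     inj_on (edge_label (\<lambda>v. the (p v))) {e \<in> edges G. e \<subseteq> dom p}"

definition legal_move :: "'a graph \<Rightarrow> 'a position \<Rightarrow> 'a \<times> nat \<Rightarrow> bool" where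
  "legal_move G p = (\<lambda>(v, l).
     v \<in> verts G \<and> v \<notin> dom p \<and> l \<in> {0..card (edges G)} \<and> l \<notin> ran p \<and>
     distinct_edge_labels G (p(v \<mapsto> l)))"

definition gracefully_labeled :: "'a graph \<Rightarrow> 'a position \<Rightarrow> bool" where
  "gracefully_labeled G p \<longleftrightarrow> dom p = verts G \<and> graceful_labeling G (\<lambda>v. the (p v))"

type_synonym 'a strategy = "'a position \<Rightarrow> 'a \<times> nat"

text \<open>\<open>reachable G first \<sigma> t p\<close>: in the game on \<open>G\<close> begun by \<open>first\<close>, position \<open>p\<close> with player
  \<open>t\<close> to move can arise when Bob moves according to \<open>\<sigma>\<close> and Alice makes arbitrary legal moves.\<close>

inductive reachable ::
  "'a graph \<Rightarrow> player \<Rightarrow> 'a strategy \<Rightarrow> player \<Rightarrow> 'a position \<Rightarrow> bool"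
  for G first \<sigma>
where
  start: "reachable G first \<sigma> first Map.empty"
| alice: "reachable G first \<sigma> Alice p \<Longrightarrow> legal_move G p (v, l) \<Longrightarrow>
    reachable G first \<sigma> Bob (p(v \<mapsto> l))"
| bob: "reachable G first \<sigma> Bob p \<Longrightarrow> \<sigma> p = (v, l) \<Longrightarrow> legal_move G p (v, l) \<Longrightarrow>
    reachable G first \<sigma> Alice (p(v \<mapsto> l))"

text \<open>Each move labels a new vertex, so every play ends, namely in a position without legal moves.
  Bob has won if the graph is not gracefully labeled then. A strategy has to supply a legal move
  whenever it is Bob's turn and there is one.\<close>

definition bob_winning_strategy :: "'a graph \<Rightarrow> player \<Rightarrow> 'a strategy \<Rightarrow> bool" where
  "bob_winning_strategy G first \<sigma> \<longleftrightarrow>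
     (\<forall>p. reachable G first \<sigma> Bob p \<and> (\<exists>mv. legal_move G p mv) \<longrightarrow> legal_move G p (\<sigma> p)) \<and>
     (\<forall>t p. reachable G first \<sigma> t p \<and> (\<nexists>mv. legal_move G p mv) \<longrightarrow> \<not> gracefully_labeled G p)"

lemma gracefully_labeled_no_legal_move:
  "gracefully_labeled G p \<Longrightarrow> \<not> legal_move G p mv"
  by (auto simp: gracefully_labeled_def legal_move_def split: prod.splits)

text \<open>A play that labels all vertices ends in a graceful labeling, so Alice's win is the same
  as the labeling being completed.\<close>

lemma reachable_invariant:
  assumes "reachable G first \<sigma> t p"
  shows "dom p \<subseteq> verts G" and "inj_on p (dom p)" and "ran p \<subseteq> {0..card (edges G)}"
    and "simple_graph G \<Longrightarrow> distinct_edge_labels G p"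
proof -
  have step: "dom (p(v \<mapsto> l)) \<subseteq> verts G \<and> inj_on (p(v \<mapsto> l)) (dom (p(v \<mapsto> l))) \<and>
      ran (p(v \<mapsto> l)) \<subseteq> {0..card (edges G)} \<and> distinct_edge_labels G (p(v \<mapsto> l))"
    if "dom p \<subseteq> verts G" "inj_on p (dom p)" "ran p \<subseteq> {0..card (edges G)}"
      "legal_move G p (v, l)" for p :: "'a position" and v l
    using that
    by (auto simp: legal_move_def inj_on_def domIff ranI split: if_splits)
  have empty: "distinct_edge_labels G Map.empty" if "simple_graph G"
  proof -
    have "{} \<notin> edges G" using that by (force simp: simple_graph_def)
    then show ?thesis by (auto simp: distinct_edge_labels_def inj_on_def)
  qed
  have "dom p \<subseteq> verts G \<and> inj_on p (dom p) \<and> ran p \<subseteq> {0..card (edges G)} \<and>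
      (simple_graph G \<longrightarrow> distinct_edge_labels G p)"
    using assms by (induction rule: reachable.induct) (use step empty in blast | simp add: empty)+
  then show "dom p \<subseteq> verts G" "inj_on p (dom p)" "ran p \<subseteq> {0..card (edges G)}"
    "simple_graph G \<Longrightarrow> distinct_edge_labels G p" by blast+
qed

lemma reachable_complete_graceful:
  assumes "simple_graph G" "reachable G first \<sigma> t p" "dom p = verts G"
  shows "gracefully_labeled G p"
proof -
  note inv = reachable_invariant[OF assms(2)]
  have "inj_on (\<lambda>v. the (p v)) (verts G)"
    using inv(2) assms(3) by (auto simp: inj_on_def) (metis domD option.sel)
  moreover have "(\<lambda>v. the (p v)) ` verts G \<subseteq> {0..card (edges G)}"
    using inv(3) by (force simp: assms(3)[symmetric] ran_def)
  moreover have "{e \<in> edges G. e \<subseteq> dom p} = edges G"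
    using assms(1,3) by (auto simp: simple_graph_def)
  ultimately show ?thesis
    using inv(4)[OF assms(1)] assms(3)
    by (simp add: gracefully_labeled_def graceful_labeling_def distinct_edge_labels_def)
qed


text \<open>The vertex \<open>v\<^sub>i\<close> of the helm is the number \<open>i\<close>.\<close>

definition helm :: "nat \<Rightarrow> nat graph" where
  "helm n =
     ({0..2 * n},
      {{0, k} | k. k \<in> {1..n}} \<union>
      {{k, k + 1} | k. k \<in> {1..<n}} \<union> {{n, 1}} \<union>
      {{k, n + k} | k. k \<in> {1..n}})"

lemma simple_graph_helm:
  assumes "n \<ge> 3"
  shows "simple_graph (helm n)"
  using assms by (auto simp: simple_graph_def helm_def card_insert_if)

lemma card_verts_helm: "card (verts (helm n)) = 2 * n + 1"
  by (simp add: helm_def)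

lemma card_edges_helm:
  assumes "n \<ge> 3"
  shows "card (edges (helm n)) = 3 * n"
proof -
  let ?A = "(\<lambda>k. {0, k}) ` {1..n}" and ?B = "(\<lambda>k. {k, k + 1}) ` {1..<n}"
    and ?C = "(\<lambda>k. {k, n + k}) ` {1..n}"
  have E: "edges (helm n) = ?A \<union> (insert {n, 1} ?B \<union> ?C)"
    by (auto simp: helm_def)
  have A: "card ?A = n"
    by (subst card_image) (auto simp: inj_on_def doubleton_eq_iff)
  have "card ?B = n - 1"
    by (subst card_image) (auto simp: inj_on_def doubleton_eq_iff)
  moreover have "{n, 1} \<notin> ?B"
    using assms by (auto simp: doubleton_eq_iff)
  ultimately have B: "card (insert {n, 1} ?B) = n"
    using assms by simp
  have C: "card ?C = n"
    by (subst card_image) (auto simp: inj_on_def doubleton_eq_iff)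
  have "insert {n, 1} ?B \<inter> ?C = {}" "?A \<inter> (insert {n, 1} ?B \<union> ?C) = {}"
    using assms by (auto simp: doubleton_eq_iff)
  then have "card (edges (helm n)) = card ?A + (card (insert {n, 1} ?B) + card ?C)"
    unfolding E by (subst card_Un_disjoint, simp, simp, simp, subst card_Un_disjoint) simp_all
  then show ?thesis
    unfolding A B C by simp
qed

end

theory Submission
  imports Defs
begin

text \<open>
  A graceful labeling of \<open>H\<^sub>n\<close> realizes all differences \<open>1, \<dots>, 3n\<close>. The difference \<open>3n\<close>
  forces the labels \<open>0\<close> and \<open>3n\<close> onto adjacent vertices, and the difference \<open>3n - 1\<close> forces \<open>0\<close> next
  to \<open>3n - 1\<close>, or \<open>1\<close> next to \<open>3n\<close>. Bob puts \<open>0\<close> on a pendent vertex, so Alice has to put \<open>3n\<close> on its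
  only neighbour at once; then Bob puts \<open>1\<close> on another pendent vertex and the difference \<open>3n - 1\<close> is
  lost. If Alice has already used \<open>1\<close>, Bob plays the complementary strategy, with \<open>x\<close> replaced by
  \<open>3n - x\<close>. If Alice opens with \<open>0\<close> or \<open>3n\<close>, Bob puts the other one on a pendent vertex away from it;
  if she opens on a cycle vertex with another label, Bob puts \<open>0\<close> on its pendent neighbour.
\<close>

section \<open>Forced wins and strategies\<close>

text \<open>Ranging over all extensions, whether or not legal play reaches them, makes deadness pass
  to every later position, so Bob's remaining moves no longer matter.\<close>

definition dead :: "'a graph \<Rightarrow> 'a position \<Rightarrow> bool" where
  "dead G p \<longleftrightarrow> (\<forall>g. p \<subseteq>\<^sub>m g \<longrightarrow> \<not> gracefully_labeled G g)"

lemma dead_mono: "dead G p \<Longrightarrow> p \<subseteq>\<^sub>m q \<Longrightarrow> dead G q"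
  unfolding dead_def using map_le_trans by blast

lemma legal_move_map_le: "legal_move G p (v, l) \<Longrightarrow> p \<subseteq>\<^sub>m p(v \<mapsto> l)"
  by (auto simp: legal_move_def map_le_def)

text \<open>The side condition in rule \<open>alice\<close> rules out a finished graceful labeling,
  where the premise about moves holds vacuously.\<close>

inductive bob_forces :: "'a graph \<Rightarrow> player \<Rightarrow> 'a position \<Rightarrow> bool" for G where
  dead: "dead G p \<Longrightarrow> bob_forces G t p"
| alice: "(\<And>v l. legal_move G p (v, l) \<Longrightarrow> bob_forces G Bob (p(v \<mapsto> l))) \<Longrightarrow>
    \<not> gracefully_labeled G p \<Longrightarrow> bob_forces G Alice p"
| bob: "legal_move G p (v, l) \<Longrightarrow> bob_forces G Alice (p(v \<mapsto> l)) \<Longrightarrow> bob_forces G Bob p"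

lemma bob_forces_not_graceful: "bob_forces G t p \<Longrightarrow> \<not> gracefully_labeled G p"
  by (induction rule: bob_forces.induct)
    (auto simp: dead_def dest: gracefully_labeled_no_legal_move)

lemma bob_forces_alice_step:
  "bob_forces G Alice p \<Longrightarrow> legal_move G p (v, l) \<Longrightarrow> bob_forces G Bob (p(v \<mapsto> l))"
  by (erule bob_forces.cases)
    (auto intro: bob_forces.dead dest: dead_mono legal_move_map_le)

lemma bob_forces_bob_step:
  assumes "bob_forces G Bob p" "legal_move G p mv"
  shows "\<exists>v l. legal_move G p (v, l) \<and> bob_forces G Alice (p(v \<mapsto> l))"
  using assms(1)
proof cases
  \<comment> \<open>From a dead position every legal move leads to a dead position, so the given
    \<open>mv\<close> serves.\<close>
  case dead
  obtain v l where "mv = (v, l)" by (cases mv)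
  with assms(2) dead show ?thesis
    by (meson bob_forces.dead dead_mono legal_move_map_le)
qed auto

text \<open>The strategy picks, by choice, a legal move that stays inside \<open>bob_forces\<close>;
  this predicate is then invariant along every play and excludes a graceful end.\<close>

lemma bob_forces_strategy:
  assumes "bob_forces G first Map.empty"
  shows "\<exists>\<sigma>. bob_winning_strategy G first \<sigma>"
proof -
  define good where "good p mv \<longleftrightarrow> legal_move G p mv \<and>
    bob_forces G Alice (p(fst mv \<mapsto> snd mv))" for p mv
  define \<sigma> where "\<sigma> p = (SOME mv. good p mv)" for p
  have \<sigma>: "good p (\<sigma> p)" if "bob_forces G Bob p" "legal_move G p mv" for p mv
  proof -
    from bob_forces_bob_step[OF that] obtain v l where "good p (v, l)"
      by (auto simp: good_def)
    then show ?thesis unfolding \<sigma>_def by (rule someI)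
  qed
  have inv: "bob_forces G t p" if "reachable G first \<sigma> t p" for t p
    using that
  proof induction
    case start
    then show ?case by (rule assms)
  next
    case (alice p v l)
    then show ?case by (blast intro: bob_forces_alice_step)
  next
    case (bob p v l)
    then show ?case using \<sigma>[of p "(v, l)"] by (simp add: good_def fun_upd_def)
  qed
  show ?thesis
    unfolding bob_winning_strategy_def using inv \<sigma> bob_forces_not_graceful good_def by blast
qed

section \<open>Graceful labelings of the helm\<close>

lemma helm_pendant_edge:
  assumes "e \<in> edges (helm n)" "n + k \<in> e" "k \<in> {1..n}"
  shows "e = {k, n + k}"
  using assms by (auto simp: helm_def)

lemma helm_edge_doubleton:
  assumes "n \<ge> 3" "e \<in> edges (helm n)"
  obtains u v where "e = {u, v}" "u \<noteq> v"
  using assms simple_graph_helm[of n] by (auto simp: simple_graph_def card_2_iff)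

lemma helm_edge_eqI:
  assumes "n \<ge> 3" "e \<in> edges (helm n)" "e \<subseteq> {a, b}"
  shows "e = {a, b}"
  using helm_edge_doubleton[OF assms(1,2)] assms(3) by (metis doubleton_eq_iff insert_subset singletonD insertE)

text \<open>Pigeonhole: the \<open>3 * n\<close> edges receive distinct labels from
  \<open>{1..3 * n}\<close>, so every value occurs.\<close>

lemma graceful_helm_difference:
  assumes n: "n \<ge> 3" and g: "gracefully_labeled (helm n) g" and d: "1 \<le> d" "d \<le> 3 * n"
  obtains u v a b where "{u, v} \<in> edges (helm n)" "g u = Some a" "g v = Some b"
    "b = a + d" "b \<le> 3 * n"
proof -
  let ?E = "edges (helm n)" and ?f = "\<lambda>v. the (g v)"
  have dom: "dom g = verts (helm n)" and inj: "inj_on ?f (verts (helm n))"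
    and ran: "?f ` verts (helm n) \<subseteq> {0..3 * n}" and injE: "inj_on (edge_label ?f) ?E"
    using g card_edges_helm[OF n] by (auto simp: gracefully_labeled_def graceful_labeling_def)
  have sub: "e \<subseteq> verts (helm n)" if "e \<in> ?E" for e
    using that simple_graph_helm[OF n] by (auto simp: simple_graph_def)
  have "edge_label ?f ` ?E \<subseteq> {1..int (3 * n)}"
  proof
    fix x assume "x \<in> edge_label ?f ` ?E"
    then obtain e where e: "e \<in> ?E" "x = edge_label ?f e" by auto
    obtain u v where uv: "e = {u, v}" "u \<noteq> v" using helm_edge_doubleton[OF n e(1)] .
    have V: "u \<in> verts (helm n)" "v \<in> verts (helm n)" using sub[OF e(1)] uv by auto
    have "?f u \<noteq> ?f v" using V uv inj by (meson inj_onD)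
    moreover have "?f u \<le> 3 * n" "?f v \<le> 3 * n" using ran V by auto
    ultimately show "x \<in> {1..int (3 * n)}"
      unfolding e(2) uv(1) edge_label_pair by auto
  qed
  moreover have "card (edge_label ?f ` ?E) = card {1..int (3 * n)}"
    using card_image[OF injE] card_edges_helm[OF n] by simp
  ultimately have "edge_label ?f ` ?E = {1..int (3 * n)}"
    by (intro card_subset_eq) auto
  then have "int d \<in> edge_label ?f ` ?E" using d by auto
  then obtain e where e: "e \<in> ?E" "int d = edge_label ?f e" by auto
  obtain u v where uv: "e = {u, v}" "u \<noteq> v" using helm_edge_doubleton[OF n e(1)] .
  have V: "u \<in> verts (helm n)" "v \<in> verts (helm n)" using sub[OF e(1)] uv by auto
  have some: "g u = Some (?f u)" "g v = Some (?f v)" using V by (auto simp: dom[symmetric])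
  have le: "?f u \<le> 3 * n" "?f v \<le> 3 * n" using ran V by auto
  have "int d = \<bar>int (?f u) - int (?f v)\<bar>" using e(2) uv(1) by (simp add: edge_label_pair)
  then consider "?f v = ?f u + d" | "?f u = ?f v + d" by linarith
  then show thesis
  proof cases
    case 1
    show ?thesis by (rule that[of u v]) (use e uv some le 1 in auto)
  next
    case 2
    show ?thesis by (rule that[of v u]) (use e uv some le 2 in \<open>auto simp: insert_commute\<close>)
  qed
qed

text \<open>\<open>z\<close> is an extreme label, \<open>w\<close> the opposite one, and \<open>x\<close> the label next to \<open>z\<close>.\<close>

definition extremes :: "nat \<Rightarrow> nat \<Rightarrow> nat \<Rightarrow> nat \<Rightarrow> bool" where
  "extremes n z w x \<longleftrightarrow> z = 0 \<and> w = 3 * n \<and> x = 1 \<or> z = 3 * n \<and> w = 0 \<and> x = 3 * n - 1"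

section \<open>Consequences of the differences \<open>3 * n\<close> and
  \<open>3 * n - 1\<close>\<close>

lemma graceful_helm_inj:
  assumes "gracefully_labeled (helm n) g" "g u = Some a" "g v = Some a"
  shows "u = v"
proof -
  have "u \<in> verts (helm n)" "v \<in> verts (helm n)" "inj_on (\<lambda>v. the (g v)) (verts (helm n))"
    using assms by (auto simp: gracefully_labeled_def graceful_labeling_def)
  then show ?thesis using assms by (metis inj_onD option.sel)
qed

text \<open>The difference \<open>3 * n\<close> arises only from \<open>0\<close> and
  \<open>3 * n\<close>, so their carriers are adjacent, and a pendent vertex has a single
  neighbour.\<close>

lemma extreme_on_pendant_forces_neighbour:
  assumes n: "n \<ge> 3" and g: "gracefully_labeled (helm n) g" and k: "k \<in> {1..n}"
    and z: "extremes n z w x" "g (n + k) = Some z"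
  shows "g k = Some w"
proof -
  have "1 \<le> 3 * n" "3 * n \<le> 3 * n" using n by auto
  then obtain u v a b where uv: "{u, v} \<in> edges (helm n)" "g u = Some a" "g v = Some b"
    "b = a + 3 * n" "b \<le> 3 * n"
    by (rule graceful_helm_difference[OF n g])
  then have "a = 0" "b = 3 * n" by auto
  then consider "u = n + k" "g v = Some w" | "v = n + k" "g u = Some w"
    using z uv graceful_helm_inj[OF g] by (auto simp: extremes_def)
  then show ?thesis
    using helm_pendant_edge[OF uv(1) _ k] k by cases (auto simp: doubleton_eq_iff)
qed

text \<open>By injectivity \<open>w\<close> is now barred from \<open>k\<close>, the only place
  where it could serve.\<close>

lemma dead_opposite_not_neighbour:
  assumes "n \<ge> 3" "k \<in> {1..n}" "extremes n z w x" "p (n + k) = Some z" "p u = Some w" "u \<noteq> k"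
  shows "dead (helm n) p"
  unfolding dead_def
proof (intro allI impI notI)
  fix g assume pg: "p \<subseteq>\<^sub>m g" and g: "gracefully_labeled (helm n) g"
  have "g (n + k) = Some z" "g u = Some w"
    using pg assms(4,5) by (metis domI map_le_def)+
  then show False
    using extreme_on_pendant_forces_neighbour[OF assms(1) g assms(2,3)] graceful_helm_inj[OF g] assms(6)
    by blast
qed

lemma dead_neighbour_not_opposite:
  assumes "n \<ge> 3" "k \<in> {1..n}" "extremes n z w x" "p (n + k) = Some z" "p k = Some y" "y \<noteq> w"
  shows "dead (helm n) p"
  unfolding dead_def
proof (intro allI impI notI)
  fix g assume pg: "p \<subseteq>\<^sub>m g" and g: "gracefully_labeled (helm n) g"
  have "g (n + k) = Some z" "g k = Some y"
    using pg assms(4,5) by (metis domI map_le_def)+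
  then show False
    using extreme_on_pendant_forces_neighbour[OF assms(1) g assms(2,3)] assms(6) by simp
qed

text \<open>The difference \<open>3 * n - 1\<close> needs \<open>z\<close> beside a label other than
  \<open>w\<close>, or \<open>x\<close> beside \<open>w\<close>. The first fails because the only
  neighbour of \<open>n + k\<close> carries \<open>w\<close>, the second because
  \<open>n + j\<close> is adjacent only to \<open>j\<close>, not to \<open>k\<close>.\<close>

lemma dead_second_difference:
  assumes n: "n \<ge> 3" and k: "k \<in> {1..n}" "j \<in> {1..n}" "j \<noteq> k" and z: "extremes n z w x"
    and p: "p (n + k) = Some z" "p k = Some w" "p (n + j) = Some x"
  shows "dead (helm n) p"
  unfolding dead_def
proof (intro allI impI notI)
  fix g assume pg: "p \<subseteq>\<^sub>m g" and g: "gracefully_labeled (helm n) g"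
  have gk: "g (n + k) = Some z" "g k = Some w" "g (n + j) = Some x"
    using pg p by (metis domI map_le_def)+
  have "1 \<le> 3 * n - 1" "3 * n - 1 \<le> 3 * n" using n by auto
  then obtain u v a b where uv: "{u, v} \<in> edges (helm n)" "g u = Some a" "g v = Some b"
    "b = a + (3 * n - 1)" "b \<le> 3 * n"
    by (rule graceful_helm_difference[OF n g])
  then have "a = 0 \<and> b = 3 * n - 1 \<or> a = 1 \<and> b = 3 * n" using n by auto
  \<comment> \<open>Orienting the edge by whether \<open>z\<close> is \<open>0\<close> makes the two
    complementary cases read alike.\<close>
  then obtain s t where st: "{s, t} \<in> edges (helm n)"
    "g s = Some z \<and> g t \<noteq> Some w \<or> g s = Some x \<and> g t = Some w"
  proof (cases "z = 0")
    case True
    with \<open>a = 0 \<and> _ \<or> _\<close> uv z n show thesis by (intro that[of u v]) (auto simp: extremes_def)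
  next
    case False
    with \<open>a = 0 \<and> _ \<or> _\<close> uv z n show thesis
      by (intro that[of v u]) (auto simp: extremes_def insert_commute)
  qed
  from st(2) show False
  proof
    assume *: "g s = Some z \<and> g t \<noteq> Some w"
    then have "s = n + k" using graceful_helm_inj[OF g] gk by blast
    then have "t = k" using helm_pendant_edge[OF st(1) _ k(1)] k by (auto simp: doubleton_eq_iff)
    then show False using * gk by simp
  next
    assume *: "g s = Some x \<and> g t = Some w"
    then have "s = n + j" "t = k" using graceful_helm_inj[OF g] gk by blast+
    then show False using helm_pendant_edge[OF st(1) _ k(2)] k by (auto simp: doubleton_eq_iff)
  qed
qed

section \<open>Bob's moves\<close>

text \<open>As the cycle neighbour is free, the move completes no edge, and the old edge labels are
  unchanged.\<close>

lemma legal_move_pendant: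
  assumes n: "n \<ge> 3" and k: "k \<in> {1..n}" "k \<notin> dom p" "n + k \<notin> dom p"
    and l: "l \<le> 3 * n" "l \<notin> ran p" and p: "distinct_edge_labels (helm n) p"
  shows "legal_move (helm n) p (n + k, l)"
proof -
  let ?q = "p(n + k \<mapsto> l)"
  have fresh: "n + k \<notin> e" if "e \<in> edges (helm n)" "e \<subseteq> dom ?q" for e
    using helm_pendant_edge[OF that(1) _ k(1)] that(2) k by auto
  have eq: "{e \<in> edges (helm n). e \<subseteq> dom ?q} = {e \<in> edges (helm n). e \<subseteq> dom p}"
    using fresh by auto
  have "edge_label (\<lambda>v. the (?q v)) e = edge_label (\<lambda>v. the (p v)) e"
    if e: "e \<in> edges (helm n)" "e \<subseteq> dom p" for e
  proof -
    obtain u v where uv: "e = {u, v}" using helm_edge_doubleton[OF n e(1)] by blast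
    then have "u \<noteq> n + k" "v \<noteq> n + k" using e k by auto
    then show ?thesis unfolding uv by (simp add: edge_label_pair)
  qed
  then have "distinct_edge_labels (helm n) ?q"
    using p unfolding distinct_edge_labels_def eq by (auto simp: inj_on_def)
  then show ?thesis
    using k l card_edges_helm[OF n] by (auto simp: legal_move_def helm_def)
qed

text \<open>With at most one completed edge in the whole graph there are no two edge labels to
  compare.\<close>

lemma legal_move_single_edge:
  assumes n: "n \<ge> 3" and v: "v \<le> 2 * n" "v \<notin> dom p" and l: "l \<le> 3 * n" "l \<notin> ran p"
    and e: "\<And>e. e \<in> edges (helm n) \<Longrightarrow> e \<subseteq> insert v (dom p) \<Longrightarrow> e = e0"
  shows "legal_move (helm n) p (v, l)"
proof -
  have "{e \<in> edges (helm n). e \<subseteq> dom (p(v \<mapsto> l))} \<subseteq> {e0}" using e by auto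
  then have "distinct_edge_labels (helm n) (p(v \<mapsto> l))"
    unfolding distinct_edge_labels_def by (rule inj_on_subset[rotated]) simp
  then show ?thesis
    using v l card_edges_helm[OF n] by (auto simp: legal_move_def helm_def)
qed

lemma bob_forces_by_dead:
  "legal_move G p (v, l) \<Longrightarrow> dead G (p(v \<mapsto> l)) \<Longrightarrow> bob_forces G Bob p"
  by (blast intro: bob_forces.intros)

text \<open>\<open>spoke n v\<close> is the index \<open>k\<close> of the pair \<open>v\<^sub>k, v\<^bsub>n+k\<^esub>\<close> containing \<open>v\<close>; it is \<open>0\<close> for the center.\<close>

definition spoke :: "nat \<Rightarrow> nat \<Rightarrow> nat" where
  "spoke n v = (if v > n then v - n else v)"

lemma spoke_pendant: "k \<in> {1..n} \<Longrightarrow> spoke n (n + k) = k"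
  and spoke_cycle: "k \<in> {1..n} \<Longrightarrow> spoke n k = k"
  by (auto simp: spoke_def)

lemma legal_move_free_spoke:
  assumes "n \<ge> 3" "k \<in> {1..n}" "k \<notin> spoke n ` dom p" "l \<le> 3 * n" "l \<notin> ran p"
    "distinct_edge_labels (helm n) p"
  shows "legal_move (helm n) p (n + k, l)"
proof -
  have "k \<notin> dom p" "n + k \<notin> dom p"
    using assms(2,3) spoke_pendant[of k n] spoke_cycle[of k n] by (metis image_eqI)+
  then show ?thesis using legal_move_pendant assms by blast
qed

lemma free_spoke:
  assumes "n \<ge> 3"
  obtains k where "k \<in> {1..n}" "k \<notin> {a, b :: nat}"
proof -
  have "\<not> {1..n} \<subseteq> {a, b}"
  proof
    assume "{1..n} \<subseteq> {a, b}"
    then have "card {1..n} \<le> card {a, b}" by (intro card_mono) auto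
    also have "\<dots> \<le> 2" by (simp add: card_insert_le_m1)
    finally show False using assms by simp
  qed
  then show ?thesis using that by blast
qed

section \<open>Play after an extreme label on a pendent vertex\<close>

text \<open>There are four kinds of reply, by whether Alice uses the vertex \<open>k\<close> and the
  label \<open>w\<close>. Each leaves a dead position or lets Bob create one with his next
  move.\<close>

lemma bob_forces_after_alice_reply:
  assumes n: "n \<ge> 3" and k: "k \<in> {1..n}" and z: "extremes n z w x"
    and q: "q (n + k) = Some z" "dom q = {n + k, v}" "w \<notin> ran q" "x \<notin> ran q"
    and v: "v \<notin> {1..n}" "v \<le> 2 * n"
    and mv: "legal_move (helm n) q (u, l)"
  shows "bob_forces (helm n) Bob (q(u \<mapsto> l))"
proof -
  let ?p = "q(u \<mapsto> l)"
  have u: "u \<le> 2 * n" "u \<notin> dom q" and dp: "distinct_edge_labels (helm n) ?p"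
    using mv by (auto simp: legal_move_def helm_def)
  have kn: "k \<noteq> v" using k v by auto
  have pk: "?p (n + k) = Some z" using u q by auto
  have dom: "dom ?p = {n + k, v, u}" using q(2) by auto
  have le: "w \<le> 3 * n" "x \<le> 3 * n" "x \<noteq> w" using z n by (auto simp: extremes_def)
  have ranp: "ran ?p = insert l (ran q)" using u by (simp add: domIff)
  have pendant: "legal_move (helm n) ?p (n + j, y)"
    if "j \<in> {1..n}" "j \<notin> {k, spoke n v, spoke n u}" "y \<le> 3 * n" "y \<notin> ran ?p" for j y
  proof (rule legal_move_free_spoke[OF n that(1) _ that(3,4) dp])
    show "j \<notin> spoke n ` dom ?p" unfolding dom using that(2) spoke_pendant[OF k] by auto
  qed
  consider (right) "u = k" "l = w" | (wrong) "u = k" "l \<noteq> w" | (used) "u \<noteq> k" "l = w"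
    | (late) "u \<noteq> k" "l \<noteq> w" by blast
  then show ?thesis
  proof cases
    case right
    \<comment> \<open>Since \<open>u = k\<close>, Alice's reply occupies no new spoke, and avoiding
      two indices suffices.\<close>
    obtain j where j: "j \<in> {1..n}" "j \<notin> {k, spoke n v}"
      using free_spoke[OF n] .
    have "legal_move (helm n) ?p (n + j, x)"
      by (rule pendant) (use j right le q(4) ranp spoke_cycle[OF k] in auto)
    moreover have "dead (helm n) (?p(n + j \<mapsto> x))"
      by (rule dead_second_difference[OF n k j(1) _ z]) (use j k pk right in auto)
    ultimately show ?thesis by (rule bob_forces_by_dead)
  next
    case wrong
    then show ?thesis
      using dead_neighbour_not_opposite[of n k z w x ?p, OF n k z pk] by (auto intro: bob_forces.dead)
  next
    case used
    then show ?thesis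
      using dead_opposite_not_neighbour[of n k z w x ?p u, OF n k z pk] by (auto intro: bob_forces.dead)
  next
    case late
    then have w: "w \<notin> ran ?p" using q ranp by auto
    \<comment> \<open>Both \<open>k\<close> and \<open>w\<close> are still available, so Bob only
      needs a legal way to put \<open>w\<close> on some vertex other than \<open>k\<close>.\<close>
    have dead: "dead (helm n) (?p(y \<mapsto> w))" if "y \<noteq> k" "y \<notin> dom ?p" for y
      by (rule dead_opposite_not_neighbour[OF n k z, where u = y])
        (use that pk dom in auto)
    show ?thesis
    proof (cases "\<exists>j\<in>{1..n}. j \<notin> {k, spoke n v, spoke n u}")
      case True
      then obtain j where j: "j \<in> {1..n}" "j \<notin> {k, spoke n v, spoke n u}" by blast
      have mv: "legal_move (helm n) ?p (n + j, w)"
        using pendant j le w by blast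
      moreover have "n + j \<noteq> k" "n + j \<notin> dom ?p"
        using j k mv by (auto simp: legal_move_def)
      ultimately show ?thesis by (rule bob_forces_by_dead[OF _ dead[of "n + j"]])
    next
      case False
      \<comment> \<open>Here \<open>n = 3\<close> and the three labeled vertices lie on different spokes, so that labeling the
        center completes at most one edge.\<close>
      then have sub: "{1..n} \<subseteq> {k, spoke n v, spoke n u}" by blast
      have card: "\<not> {1..n} \<subseteq> {a, b}" for a b
        using free_spoke[OF n, of a b] by blast
      have "spoke n v \<noteq> k" "spoke n u \<noteq> k" "spoke n v \<noteq> spoke n u"
        using sub card[of k "spoke n u"] card[of k "spoke n v"] by auto
      moreover have "v \<noteq> 0" "u \<noteq> 0"
      proof -
        show "v \<noteq> 0" using sub card[of k "spoke n u"] by (force simp: spoke_def)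
        show "u \<noteq> 0" using sub card[of k "spoke n v"] by (force simp: spoke_def)
      qed
      ultimately obtain i where i: "v = n + i" "i \<in> {1..n}" "i \<noteq> k" "i \<noteq> u"
        using v by (intro that[of "v - n"]) (auto simp: spoke_def split: if_splits)
      \<comment> \<open>The pendent vertices \<open>n + k\<close> and \<open>v = n + i\<close> have
        the free neighbours \<open>k\<close> and \<open>i\<close>, which leaves only the edge
        \<open>{0, u}\<close>.\<close>
      have "legal_move (helm n) ?p (0, w)"
      proof (rule legal_move_single_edge[OF n, where ?e0.0 = "{0, u}"])
        fix e assume e: "e \<in> edges (helm n)" "e \<subseteq> insert 0 (dom ?p)"
        then have e': "e \<subseteq> {0, n + k, v, u}" unfolding dom by auto
        have "n + k \<notin> e"
        proof
          assume "n + k \<in> e"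
          then have "k \<in> e" using helm_pendant_edge[OF e(1) _ k] by simp
          with e' k late kn show False by auto
        qed
        moreover have "v \<notin> e"
        proof
          assume "v \<in> e"
          then have "i \<in> e" using helm_pendant_edge[OF e(1) _ i(2)] i(1) by simp
          with e' i k n show False by auto
        qed
        ultimately have "e \<subseteq> {0, u}" using e' by auto
        then show "e = {0, u}"
          by (rule helm_edge_eqI[OF n e(1)])
      qed (use \<open>v \<noteq> 0\<close> \<open>u \<noteq> 0\<close> k le w dom in auto)
      moreover have "0 \<noteq> k" "0 \<notin> dom ?p"
        unfolding dom using k \<open>v \<noteq> 0\<close> \<open>u \<noteq> 0\<close> by auto
      ultimately show ?thesis by (rule bob_forces_by_dead[OF _ dead[of 0]])
    qed
  qed
qed

lemma bob_forces_after_extreme_on_pendant: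
  assumes n: "n \<ge> 3" and k: "k \<in> {1..n}" and z: "extremes n z w x"
    and q: "q (n + k) = Some z" "dom q = {n + k, v}" "w \<notin> ran q" "x \<notin> ran q"
    and v: "v \<notin> {1..n}" "v \<le> 2 * n"
  shows "bob_forces (helm n) Alice q"
proof (rule bob_forces.alice)
  show "bob_forces (helm n) Bob (q(u \<mapsto> l))" if "legal_move (helm n) q (u, l)" for u l
    using bob_forces_after_alice_reply[OF n k z q v that] .
  have "card (dom q) \<le> 2" unfolding q(2) by (simp add: card_insert_if)
  then show "\<not> gracefully_labeled (helm n) q"
    using card_verts_helm[of n] n by (auto simp: gracefully_labeled_def)
qed

section \<open>Opening moves of either player\<close>

lemma distinct_edge_labels_empty: "n \<ge> 3 \<Longrightarrow> distinct_edge_labels (helm n) Map.empty"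
  using reachable_invariant(4)[OF reachable.start] simple_graph_helm by blast

lemma bob_forces_moving_first:
  assumes n: "n \<ge> 3"
  shows "bob_forces (helm n) Bob Map.empty"
proof (rule bob_forces.bob)
  show "legal_move (helm n) Map.empty (n + 1, 0)"
    by (rule legal_move_pendant) (use n distinct_edge_labels_empty[OF n] in auto)
  show "bob_forces (helm n) Alice [n + 1 \<mapsto> 0]"
    \<comment> \<open>No second vertex is labeled yet; taking \<open>v\<close> to be the pendent
      vertex itself makes the domain a singleton.\<close>
    by (rule bob_forces_after_extreme_on_pendant[where k = 1 and z = 0 and w = "3 * n" and x = 1
          and v = "n + 1"])
      (use n in \<open>auto simp: extremes_def\<close>)
qed

lemma bob_forces_after_opening:
  assumes n: "n \<ge> 3" and mv: "legal_move (helm n) Map.empty (v, l)"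
  shows "bob_forces (helm n) Bob [v \<mapsto> l]"
proof -
  let ?p = "[v \<mapsto> l]"
  have v: "v \<le> 2 * n" and l: "l \<le> 3 * n" and dp: "distinct_edge_labels (helm n) ?p"
    using mv card_edges_helm[OF n] by (auto simp: legal_move_def helm_def)
  obtain k where k: "k \<in> {1..n}" "k \<noteq> spoke n v"
    using free_spoke[OF n, of "spoke n v" "spoke n v"] by blast
  have pendant: "legal_move (helm n) ?p (n + k, y)" if "y \<le> 3 * n" "y \<noteq> l" for y
    by (rule legal_move_free_spoke) (use n k that dp in auto)
  have kv: "v \<noteq> k" "v \<noteq> n + k" using k spoke_pendant[of k n] spoke_cycle[of k n] by auto
  consider (extreme) "l = 0 \<or> l = 3 * n" | (cycle) "l \<noteq> 0" "l \<noteq> 3 * n" "v \<in> {1..n}"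
    | (rest) "l \<noteq> 0" "l \<noteq> 3 * n" "v \<notin> {1..n}" by blast
  then show ?thesis
  proof cases
    case extreme
    \<comment> \<open>The roles are swapped: Bob's answer \<open>w\<close> is the extreme label on
      the pendent vertex, and Alice's \<open>l\<close> is its opposite.\<close>
    then obtain w x where z: "extremes n w l x" "w \<le> 3 * n" "w \<noteq> l"
      using n by (auto simp: extremes_def)
    have "dead (helm n) (?p(n + k \<mapsto> w))"
      by (rule dead_opposite_not_neighbour[OF n k(1) z(1), where u = v]) (use kv in auto)
    then show ?thesis by (rule bob_forces_by_dead[OF pendant[OF z(2,3)]])
  next
    case cycle
    have "legal_move (helm n) ?p (n + v, 0)"
    proof (rule legal_move_single_edge[OF n, where ?e0.0 = "{v, n + v}"])
      fix e assume e: "e \<in> edges (helm n)" "e \<subseteq> insert (n + v) (dom ?p)"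
      then have "e \<subseteq> {v, n + v}" by auto
      then show "e = {v, n + v}" by (rule helm_edge_eqI[OF n e(1)])
    qed (use cycle n in auto)
    moreover have "dead (helm n) (?p(n + v \<mapsto> 0))"
      by (rule dead_neighbour_not_opposite[OF n cycle(3), where y = l and z = 0 and w = "3 * n" and x = 1])
        (use cycle n in \<open>auto simp: extremes_def\<close>)
    ultimately show ?thesis by (rule bob_forces_by_dead)
  next
    case rest
    \<comment> \<open>The extreme \<open>0\<close> needs \<open>1\<close> as the later label
      \<open>x\<close>. If Alice has spent \<open>1\<close>, the complementary triple is free, since
      \<open>3 * n - 1\<close> differs from \<open>1\<close>.\<close>
    obtain z w x where z: "extremes n z w x" "z \<le> 3 * n" "l \<notin> {z, w, x}" "w \<noteq> z" "x \<noteq> z"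
    proof (cases "l = 1")
      case True
      show thesis
        by (rule that[of "3 * n" 0 "3 * n - 1"]) (use True n in \<open>auto simp: extremes_def\<close>)
    next
      case False
      show thesis
        by (rule that[of 0 "3 * n" 1]) (use False rest n in \<open>auto simp: extremes_def\<close>)
    qed
    have "bob_forces (helm n) Alice (?p(n + k \<mapsto> z))"
      by (rule bob_forces_after_extreme_on_pendant[OF n k(1) z(1), where v = v])
        (use z rest v kv in auto)
    then show ?thesis by (rule bob_forces.bob[OF pendant, rotated -1]) (use z in auto)
  qed
qed

theorem theorem9:
  fixes n :: nat and first :: player
  assumes "n \<ge> 3"
  shows "\<exists>\<sigma>. bob_winning_strategy (helm n) first \<sigma>"
proof (rule bob_forces_strategy, cases first)
  case Alice
  have "\<not> gracefully_labeled (helm n) Map.empty"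
    using assms by (auto simp: gracefully_labeled_def helm_def)
  then show "bob_forces (helm n) first Map.empty"
    unfolding Alice using bob_forces_after_opening[OF assms] by (blast intro: bob_forces.alice)
next
  case Bob
  then show "bob_forces (helm n) first Map.empty"
    using bob_forces_moving_first[OF assms] by simp
qed

end
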